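(* Let $\mathcal{R}$ be an infinite commutative integral domain with identity. A polynomial function $F\colon\mathcal{R}^*\to\mathcal{R}$ is B-associative if and only if one of the following two conditions holds. (i) There exist $z\in\mathcal{R}$ and $k$, where $k\geqslant 1$ is an integer or $k=\infty$, with $k\leqslant n(z)$, such that $F\in [M^z]_k$. (ii) There exists a polynomial function $Q\colon\mathcal{R}^2\to\mathcal{R}$ of degree $\geqslant 1$ such that $F_1(x)=x$ for all $x\in\mathcal{R}$, $F_2(x,y)=Q(x,y)\,x+(1-Q(x,y))\,y$ for all $x,y\in\mathcal{R}$, and $F_n$ is constant for every $n\geqslant 3$.
   Context: $\mathbb{N}$ is the set of nonnegative integers. For a nonempty set $X$, $X^*=\bigcup_{n\in\mathbb{N}}X^n$ is the set of all tuples on $X$, with $X^0=\{\varepsilon\}$. By a slight abuse of notation, every function $F\colon X^*\to X$ considered satisfies $F(\varepsilon)=\varepsilon$ (so only the values on nonempty tuples matter). The $n$-ary part of $F$ is $F_n=F|_{X^n}$. Tuples are concatenated: $F(\mathbf{x},\mathbf{y})=F(x_1,\ldots,x_n,y_1,\ldots,y_m)$ for $\mathbf{x}=(x_1,\ldots,x_n)$, $\mathbf{y}=(y_1,\ldots,y_m)$, and similarly for more tuples; $k\cdot x$ means that the argument $x$ is repeated $k$ times. A function $F\colon X^*\to X$ is B-associative (barycentrically associative) if $F(\mathbf{x},\mathbf{y},\mathbf{z})=F(\mathbf{x},k\cdot F(\mathbf{y}),\mathbf{z})$ for every $k\in\mathbb{N}$, all $\mathbf{x},\mathbf{z}\in X^*$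 and all $\mathbf{y}\in X^k$. A function $F\colon\mathcal{R}^*\to\mathcal{R}$ is called a polynomial function if $F_n\colon\mathcal{R}^n\to\mathcal{R}$ is a polynomial function (with coefficients in $\mathcal{R}$) for every integer $n\geqslant 1$. Since $\mathcal{R}$ is an infinite integral domain, polynomials in $n$ indeterminates over $\mathcal{R}$ are identified with polynomial functions $\mathcal{R}^n\to\mathcal{R}$; degree means total degree. For $z\in\mathcal{R}$ and an integer $n\geqslant 1$, let $\Delta_n^z=\sum_{i=1}^n z^{n-i}(1-z)^{i-1}$ (with $0^0=1$). If $\Delta_n^z$ is invertible in $\mathcal{R}$, define $M_n^z\colon\mathcal{R}^n\to\mathcal{R}$ by $M_n^z(\mathbf{x})=(\Delta_n^z)^{-1}\sum_{i=1}^n z^{n-i}(1-z)^{i-1}x_i$. Let $n(z)=\inf\{n\geqslant 1:\Delta_n^z\text{ is not invertible in }\mathcal{R}\}$, with $n(z)=\infty$ if $\Delta_n^z$ is invertible for every $n\geqslant 1$. The function $M^z\colon\mathcal{R}^*\to\mathcal{R}$ is the one whose restriction to $\mathcal{R}^n$ ($n\geqslant 1$) is $M_n^z$ if $n<n(z)$ and the constant $0$ otherwise. For $F\colon X^*\to X$ and $k\geqslant 1$ an integer or $k=\infty$, $[F]_k$ is the class of functions $G\colon X^*\to X$ obtained from $F$ by replacing $F_n$ with a constant function for every $n\geqslant k$ (the constant may depend on $n$), leaving $F_n$ unchanged for $n<k$. In particular $[F]_\infty=\{F\}$. *)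

theory Defs
  imports "HOL-Library.Poly_Mapping" "HOL-Library.Extended_Nat"
begin

text \<open>
  A function on \<open>X\<^sup>*\<close> is modelled as \<open>F :: 'a list \<Rightarrow> 'a\<close>, its \<open>n\<close>-ary part being the restriction
  to lists of length \<open>n\<close>. The convention that \<open>F\<close> maps the empty tuple to itself cannot be typed
  this way; instead the value \<open>F []\<close> is left arbitrary and none of the notions below depends on it.
\<close>

text \<open>For \<open>ys = []\<close> the condition is trivial, as \<open>replicate 0 (F []) = []\<close>.\<close>

definition B_associative :: "('a list \<Rightarrow> 'a) \<Rightarrow> bool" where
  "B_associative F \<longleftrightarrow>
     (\<forall>xs ys zs. F (xs @ ys @ zs) = F (xs @ replicate (length ys) (F ys) @ zs))"

definition const_part :: "nat \<Rightarrow> ('a list \<Rightarrow> 'a) \<Rightarrow> bool" where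
  "const_part n F \<longleftrightarrow> (\<exists>c. \<forall>xs. length xs = n \<longrightarrow> F xs = c)"

text \<open>
  Polynomials in indeterminates indexed by \<open>nat\<close>: finitely supported maps from monomials
  (finitely supported exponent vectors) to coefficients.
\<close>

type_synonym 'a mpol = "(nat \<Rightarrow>\<^sub>0 nat) \<Rightarrow>\<^sub>0 'a"

definition mpol_in :: "nat \<Rightarrow> 'a::zero mpol \<Rightarrow> bool" where
  "mpol_in n p \<longleftrightarrow> (\<forall>m \<in> Poly_Mapping.keys p. Poly_Mapping.keys m \<subseteq> {..<n})"

definition mpol_eval :: "'a::comm_semiring_1 mpol \<Rightarrow> 'a list \<Rightarrow> 'a" where
  "mpol_eval p xs =
     (\<Sum>m \<in> Poly_Mapping.keys p. Poly_Mapping.lookup p m *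
        (\<Prod>i \<in> Poly_Mapping.keys m. (xs ! i) ^ Poly_Mapping.lookup m i))"

text \<open>The zero polynomial gets degree \<open>0\<close>.\<close>

definition total_deg :: "'a::zero mpol \<Rightarrow> nat" where
  "total_deg p =
     Max (insert 0 ((\<lambda>m. \<Sum>i \<in> Poly_Mapping.keys m. Poly_Mapping.lookup m i) `
       Poly_Mapping.keys p))"

definition polynomial_function :: "('a::comm_semiring_1 list \<Rightarrow> 'a) \<Rightarrow> bool" where
  "polynomial_function F \<longleftrightarrow>
     (\<forall>n\<ge>1. \<exists>p. mpol_in n p \<and> (\<forall>xs. length xs = n \<longrightarrow> F xs = mpol_eval p xs))"

definition Delta :: "'a::comm_ring_1 \<Rightarrow> nat \<Rightarrow> 'a" where
  "Delta z n = (\<Sum>i=1..n. z ^ (n - i) * (1 - z) ^ (i - 1))"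

text \<open>The infimum of the empty set is \<open>\<infinity>\<close>.\<close>

definition n_of :: "'a::comm_ring_1 \<Rightarrow> enat" where
  "n_of z = (INF n \<in> {n. 1 \<le> n \<and> \<not> Delta z n dvd 1}. enat n)"

text \<open>Meaningful for units only.\<close>

definition unit_inv :: "'a::comm_ring_1 \<Rightarrow> 'a" where
  "unit_inv a = (THE b. a * b = 1)"

text \<open>Tuples are indexed from \<open>1\<close>, lists from \<open>0\<close>.\<close>

definition M :: "'a::comm_ring_1 \<Rightarrow> 'a list \<Rightarrow> 'a" where
  "M z xs = (let n = length xs in
     if enat n < n_of z
     then unit_inv (Delta z n) * (\<Sum>i=1..n. z ^ (n - i) * (1 - z) ^ (i - 1) * xs ! (i - 1))
     else 0)"

definition repl_class :: "('a list \<Rightarrow> 'a) \<Rightarrow> enat \<Rightarrow> ('a list \<Rightarrow> 'a) set" where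
  "repl_class F k = {G.
     (\<forall>xs. xs \<noteq> [] \<and> enat (length xs) < k \<longrightarrow> G xs = F xs) \<and>
     (\<forall>n\<ge>1. k \<le> enat n \<longrightarrow> const_part n G)}"

end

theory Submission
  imports Defs "HOL-Computational_Algebra.Polynomial"
begin

text \<open>
  For each \<open>n\<close> the diagonal \<open>x \<mapsto> F(n\<cdot>x)\<close> is an idempotent polynomial under composition, hence constant
  or the identity, and constancy of \<open>F\<^sub>n\<close> passes to \<open>F\<^sub>n\<^sub>+\<^sub>1\<close>. If \<open>F\<^sub>2\<close> is idempotent, then \<open>x - y\<close> divides
  \<open>F\<^sub>2(x,y) - y\<close>, which gives \<open>Q\<close>.

  Suppose \<open>F\<^sub>3\<close> is not constant, and put \<open>P = F\<^sub>2\<close>, \<open>S(x,z) = F(x,x,z)\<close>, \<open>T(x,z) = F(x,z,z)\<close>, so that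
  \<open>S(P(x,y),z) = T(x,P(y,z))\<close>. Comparing the coefficients of powers of \<open>x\<close> shows first that the leading
  coefficients in \<open>x\<close> are constants, and then that \<open>T\<^sub>e(P(y,z)) = U(y) + V(z)\<close> for some nonconstant
  coefficient \<open>T\<^sub>e\<close> of \<open>T\<close>. If \<open>p = deg\<^sub>x P\<close> is at least \<open>2\<close>, this bounds the total degree of \<open>P\<close> by \<open>p\<close>, so
  \<open>T(x,x)\<close> has degree \<open>deg\<^sub>x T \<ge> 2\<close>, against \<open>T(x,x) = x\<close>. Therefore \<open>P = z x + (1 - z) y\<close>. No derivatives
  occur, so the characteristic is irrelevant.

  With this \<open>F\<^sub>2\<close>, a nonconstant \<open>F\<^sub>n\<close> satisfies \<open>\<Delta> F\<^sub>n(x) = \<Sum> z\<^sup>n\<^sup>-\<^sup>i (1 - z)\<^sup>i\<^sup>-\<^sup>1 x\<^sub>i\<close>, where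
  \<open>\<Delta> = Delta z n\<close>. Evaluating at unit vectors, \<open>\<Delta>\<close> divides the comaximal elements \<open>z\<^sup>n\<^sup>-\<^sup>1\<close> and
  \<open>(1 - z)\<^sup>n\<^sup>-\<^sup>1\<close>, so it is a unit.
\<close>

section \<open>Polynomials over an infinite domain\<close>

lemma poly_eqI_infinite:
  fixes p q :: "'a::idom poly"
  assumes "infinite {x. poly p x = poly q x}"
  shows "p = q"
proof (rule ccontr)
  assume "p \<noteq> q"
  then have "finite {x. poly (p - q) x = 0}"
    by (intro poly_roots_finite) simp
  then show False using assms by simp
qed

lemma poly_ext_infinite:
  fixes p q :: "'a::idom poly"
  assumes "infinite (UNIV :: 'a set)" "\<And>x. poly p x = poly q x"
  shows "p = q"
  by (rule poly_eqI_infinite) (use assms in simp)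

lemma exists_nonroot:
  fixes p :: "'a::idom poly"
  assumes "infinite (UNIV :: 'a set)" "p \<noteq> 0"
  obtains x where "poly p x \<noteq> 0"
  using poly_ext_infinite[OF assms(1), of p 0] assms(2) by auto

text \<open>Degree bounds instead of exact degrees, because a section of a bivariate polynomial can
  lose degree at special parameter values.\<close>

lemma coeff_mult_bound:
  fixes p q :: "'a::idom poly"
  assumes "degree p \<le> m" "degree q \<le> n"
  shows "coeff (p * q) (m + n) = coeff p m * coeff q n"
proof (cases "degree p = m \<and> degree q = n")
  case True
  then show ?thesis by (metis coeff_mult_degree_sum)
next
  case False
  then have "degree p < m \<or> degree q < n" using assms by auto
  then have "coeff p m * coeff q n = 0" by (auto simp: coeff_eq_0)
  moreover have "degree (p * q) < m + n"
    using degree_mult_le[of p q] False assms by linarith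
  ultimately show ?thesis by (simp add: coeff_eq_0)
qed

text \<open>Horner's scheme: \<open>pCons c r\<close> composed with \<open>q\<close> is
  \<open>c\<close> plus \<open>q\<close> times the composition of \<open>r\<close> with
  \<open>q\<close>; \<open>0 < n\<close> keeps \<open>c\<close> out of the top coefficient.\<close>

lemma coeff_pcompose_bound:
  fixes p q :: "'a::idom poly"
  assumes "degree p \<le> m" "degree q \<le> n" "0 < n"
  shows "coeff (pcompose p q) (m * n) = coeff p m * coeff q n ^ m"
  using assms(1)
proof (induction m arbitrary: p)
  case 0
  then obtain c where "p = [:c:]" by (metis degree_eq_zeroE le_zero_eq)
  then show ?case by simp
next
  case (Suc m)
  obtain c r where p: "p = pCons c r" by (cases p)
  have r: "degree r \<le> m" using Suc.prems unfolding p by (auto split: if_splits)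
  have dr: "degree (pcompose r q) \<le> m * n"
    using degree_pcompose_le[of r q] r assms(2) by (meson mult_le_mono order_trans)
  have "coeff (pcompose p q) (Suc m * n) = coeff (q * pcompose r q) (n + m * n)"
    using assms(3) by (simp add: p pcompose_pCons coeff_pCons split: nat.split)
  also have "\<dots> = coeff q n * (coeff r m * coeff q n ^ m)"
    using coeff_mult_bound[OF assms(2) dr] Suc.IH[OF r] by simp
  finally show ?case by (simp add: p mult_ac)
qed

text \<open>Composing \<open>p\<close> with itself squares the degree, so the degree is 0 or 1; in
  degree 1, comparing coefficients leaves only the identity.\<close>

lemma idempotent_poly_cases:
  fixes p :: "'a::idom poly"
  assumes inf: "infinite (UNIV :: 'a set)" and idem: "\<And>x. poly p (poly p x) = poly p x"
  shows "(\<exists>c. p = [:c:]) \<or> p = [:0, 1:]"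
proof -
  have pp: "pcompose p p = p"
    by (rule poly_ext_infinite[OF inf]) (simp add: poly_pcompose idem)
  then have "degree p * degree p = degree p" by (metis degree_pcompose)
  then consider "degree p = 0" | "degree p = 1" by auto
  then show ?thesis
  proof cases
    case 1
    then show ?thesis by (metis degree_eq_zeroE)
  next
    case 2
    then obtain b a where p: "p = [:b, a:]" "a \<noteq> 0" by (metis degree1_coeffs)
    have "a * a = a" "a * b = 0"
      using pp by (simp_all add: p pcompose_pCons)
    then show ?thesis using p by simp
  qed
qed

section \<open>Bivariate polynomials and their sections\<close>

text \<open>The outer variable is \<open>x\<close>: \<open>degree H\<close> is the degree in
  \<open>x\<close>, and \<open>coeff H i\<close> is a polynomial in \<open>y\<close>. Fixing
  \<open>x\<close> gives \<open>poly H [:x:]\<close>, fixing \<open>y\<close> gives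
  \<open>sect H y\<close> below.\<close>

definition ev2 :: "'a::idom poly poly \<Rightarrow> 'a \<Rightarrow> 'a \<Rightarrow> 'a" where
  "ev2 H x y = poly (poly H [:x:]) y"

definition sect :: "'a::idom poly poly \<Rightarrow> 'a \<Rightarrow> 'a poly" where
  "sect H y = map_poly (\<lambda>c. poly c y) H"

lemma coeff_sect [simp]: "coeff (sect H y) i = poly (coeff H i) y"
  by (simp add: sect_def coeff_map_poly)

lemma degree_sect_le: "degree (sect H y) \<le> degree H"
  by (rule degree_le) (simp add: coeff_eq_0)

lemma poly_sect: "poly (sect H y) x = ev2 H x y"
  by (induction H) (simp_all add: sect_def ev2_def map_poly_pCons)

lemma poly_poly_eq_ev2: "poly (poly H q) t = ev2 H (poly q t) t"
  by (induction H) (simp_all add: ev2_def)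

lemma ev2_altdef: "ev2 H x y = (\<Sum>i\<le>degree H. poly (coeff H i) y * x ^ i)"
  by (simp add: ev2_def poly_altdef[of H] poly_sum)

lemma poly_poly_const: "poly (poly H [:x:]) y = ev2 H x y"
  by (simp add: ev2_def)

section \<open>Binary polynomials with a barycentric ternary extension\<close>

text \<open>For the intended \<open>P\<close>, \<open>S\<close>, \<open>T\<close>, both sides of
  \<open>eq\<close> compute F(x,y,z). If \<open>P\<close> is not linear, counting degrees
  contradicts T(x,x) = x.\<close>

lemma barycentric_linear:
  fixes P S T :: "'a::idom poly poly"
  assumes inf: "infinite (UNIV :: 'a set)"
    and P_id: "\<And>x. ev2 P x x = x"
    and S_id: "\<And>x. ev2 S x x = x"
    and T_id: "\<And>x. ev2 T x x = x"
    and eq: "\<And>x y z. ev2 S (ev2 P x y) z = ev2 T x (ev2 P y z)"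
  shows "\<exists>\<alpha>. \<forall>x y. ev2 P x y = \<alpha> * x + (1 - \<alpha>) * y"
proof (rule ccontr)
  note ext = poly_ext_infinite[OF inf]
  assume neg: "\<not> ?thesis"
  have NX: "\<not> (\<forall>x y. ev2 P x y = x)"
    using neg[simplified, rule_format, of 1] by auto
  have NY: "\<not> (\<forall>x y. ev2 P x y = y)"
    using neg[simplified, rule_format, of 0] by auto
  define p where "p = degree P"
  define s where "s = degree S"
  define a where "a = coeff P p"
  define b where "b = coeff S s"
  have p_pos: "0 < p"
  proof (rule ccontr)
    assume "\<not> 0 < p"
    then obtain c where "P = [:c:]" unfolding p_def by (metis degree_eq_zeroE gr0I)
    then have "ev2 P x y = poly c y" for x y by (simp add: ev2_def)
    then show False using NY P_id by metis
  qed
  have s_pos: "0 < s"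
  proof (rule ccontr)
    assume "\<not> 0 < s"
    then obtain c where "S = [:c:]" unfolding s_def by (metis degree_eq_zeroE gr0I)
    then have "ev2 S x y = poly c y" for x y by (simp add: ev2_def)
    then have S: "ev2 S x y = y" for x y using S_id by metis
    have "ev2 T x z = z" for x z using eq[of x z z] by (simp add: S P_id)
    then show False using NY eq S by metis
  qed
  have a0: "a \<noteq> 0" using p_pos unfolding a_def p_def by auto
  have b0: "b \<noteq> 0" using s_pos unfolding b_def s_def by auto
  have dP: "degree (sect P y) \<le> p" for y by (simp add: p_def degree_sect_le)
  have dS: "degree (sect S y) \<le> s" for y by (simp add: s_def degree_sect_le)
  \<comment> \<open>For fixed \<open>y\<close> and \<open>z\<close>, both sides of \<open>eq\<close>
    are polynomials in \<open>x\<close>; their coefficients are compared from here on.\<close>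
  have comp: "pcompose (sect S z) (sect P y) = sect T (ev2 P y z)" for y z
    by (rule ext) (simp add: poly_pcompose poly_sect eq)
  have coeffs: "poly (coeff T i) (ev2 P y z) = coeff (pcompose (sect S z) (sect P y)) i" for i y z
    by (simp add: comp)
  define t where "t = s * p"
  have lead: "poly (coeff T t) (ev2 P y z) = poly b z * poly a y ^ s" for y z
    unfolding coeffs t_def
    by (simp add: coeff_pcompose_bound[OF dS dP p_pos] a_def b_def)
  \<comment> \<open>Put \<open>y = z\<close> in \<open>lead\<close> and use P(y,y) = y.\<close>
  have Tt: "coeff T t = b * a ^ s"
    by (rule ext) (use lead in \<open>metis P_id poly_mult poly_power\<close>)
  have Tt0: "coeff T t \<noteq> 0" using a0 b0 by (simp add: Tt)
  \<comment> \<open>Otherwise P(x,y) = x for the infinitely many \<open>x\<close> with a(x) nonzero,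
    hence for all \<open>x\<close>, against \<open>NX\<close>.\<close>
  obtain y0 where y0: "poly a y0 \<noteq> 0" "0 < degree (poly P [:y0:])"
  proof (rule ccontr)
    assume "\<not> thesis"
    with that have const: "degree (poly P [:y0:]) = 0" if "poly a y0 \<noteq> 0" for y0
      using \<open>poly a y0 \<noteq> 0\<close> by blast
    have "infinite {x. poly a x \<noteq> 0}"
      using poly_roots_finite[OF a0] inf Diff_infinite_finite[of "{x. poly a x = 0}" UNIV]
      by (simp add: Collect_neg_eq Compl_eq_Diff_UNIV)
    moreover have "ev2 P x y = x" if x: "poly a x \<noteq> 0" for x y
    proof -
      obtain c where "poly P [:x:] = [:c:]" using const[OF x] by (metis degree_eq_zeroE)
      then show ?thesis using P_id[of x] by (simp add: ev2_def)
    qed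
    ultimately have "infinite {x. ev2 P x y = x}" for y
      by (metis (mono_tags, lifting) Collect_mono infinite_super)
    then have "sect P y = [:0, 1:]" for y
      by (intro poly_eqI_infinite) (simp add: poly_sect)
    then have "ev2 P x y = x" for x y using poly_sect[of P y x] by simp
    then show False using NX by blast
  qed
  obtain z0 where z0: "poly a z0 \<noteq> 0" "poly b z0 \<noteq> 0"
    using exists_nonroot[OF inf, of "a * b"] a0 b0 by auto
  \<comment> \<open>Fixing \<open>y = y0\<close> in \<open>lead\<close> and comparing degrees in
    \<open>z\<close> gives \<open>m \<le> degree b\<close>; fixing \<open>z = z0\<close> gives
    \<open>m \<le> s * degree a\<close>. As \<open>m\<close> is the sum of both bounds, both
    vanish.\<close>
  have ab: "degree a = 0" "degree b = 0"
  proof -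
    define m where "m = degree (coeff T t)"
    have m: "m = degree b + s * degree a"
      using a0 b0 by (simp add: m_def Tt degree_mult_eq degree_power_eq)
    have "pcompose (coeff T t) (poly P [:y0:]) = smult (poly a y0 ^ s) b"
      by (rule ext) (simp add: poly_pcompose poly_poly_const lead)
    then have 1: "m * degree (poly P [:y0:]) = degree b"
      unfolding m_def by (metis degree_pcompose degree_smult_eq power_not_zero y0(1))
    have "pcompose (coeff T t) (sect P z0) = smult (poly b z0) (a ^ s)"
      by (rule ext) (simp add: poly_pcompose poly_sect lead)
    then have "m * degree (sect P z0) = degree (a ^ s)"
      unfolding m_def by (metis degree_pcompose degree_smult_eq z0(2))
    moreover have "p \<le> degree (sect P z0)"
      by (rule le_degree) (use z0 in \<open>simp add: a_def\<close>)
    ultimately have 2: "m * p \<le> s * degree a"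
      using a0 by (metis degree_power_eq mult.commute mult_le_mono2)
    have "m \<le> degree b" using 1 y0(2) by (cases "degree (poly P [:y0:])") auto
    moreover have "m \<le> s * degree a" using 2 p_pos by (cases p) auto
    ultimately have "degree b = 0 \<and> s * degree a = 0"
      using m 1 2 by auto
    then show "degree a = 0" "degree b = 0" using s_pos by auto
  qed
  obtain \<alpha> where \<alpha>: "a = [:\<alpha>:]" "\<alpha> \<noteq> 0" using ab(1) a0 by (metis degree_eq_zeroE pCons_0_0)
  have degP: "degree (sect P y) = p" for y
    using dP[of y] le_degree[of "sect P y" p] \<alpha> by (simp add: a_def[symmetric])
  have p2: "2 \<le> p"
  proof (rule ccontr)
    assume "\<not> 2 \<le> p"
    then have "p = 1" using p_pos by simp
    then obtain g where "P = [:g, [:\<alpha>:]:]"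
      using \<alpha> unfolding a_def p_def by (metis One_nat_def coeff_pCons_0 coeff_pCons_Suc degree1_coeffs)
    then have P: "ev2 P x y = poly g y + \<alpha> * x" for x y by (simp add: ev2_def)
    have "ev2 P x y = \<alpha> * x + (1 - \<alpha>) * y" for x y
      using P_id[of y] P[of y y] P[of x y] by (simp add: algebra_simps)
    then show False using neg by blast
  qed

  text \<open>The highest coefficient of \<open>S(u,z)\<close> in \<open>u\<close> that depends on \<open>z\<close>.\<close>
  define D where "D = {i. degree (coeff S i) \<noteq> 0}"
  have "D \<subseteq> {..degree S}"
    unfolding D_def by (auto intro: le_degree)
  then have finD: "finite D" by (rule finite_subset) simp
  \<comment> \<open>Otherwise S(u,z) = u, so T(x,P(y0,z)) does not depend on \<open>z\<close>. Since
    P(y0,z) does, T(x,w) = x, and \<open>eq\<close> makes \<open>P\<close> the first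
    projection.\<close>
  have "D \<noteq> {}"
  proof
    assume "D = {}"
    then have "\<exists>c. coeff S i = [:c:]" for i
      unfolding D_def by (metis (mono_tags, lifting) degree_eq_zeroE empty_Collect_eq)
    then have "poly (coeff S i) z = poly (coeff S i) z'" for i z z'
      by (metis mult_zero_right poly_0 poly_pCons)
    then have "sect S z = sect S z'" for z z' by (intro poly_eqI) simp
    then have S: "ev2 S u z = u" for u z using poly_sect S_id by metis
    have "ev2 T x w = x" for x w
    proof -
      have "pcompose (poly T [:x:]) (poly P [:y0:]) = [:ev2 P x y0:]"
        by (rule ext) (simp add: poly_pcompose poly_poly_const eq[symmetric] S)
      then have "degree (poly T [:x:]) * degree (poly P [:y0:]) = 0"
        by (metis degree_pcompose degree_pCons_0)
      then have "degree (poly T [:x:]) = 0" using y0(2) by simp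
      then obtain c where "poly T [:x:] = [:c:]" by (metis degree_eq_zeroE)
      then show ?thesis using T_id[of x] by (simp add: ev2_def)
    qed
    then show False using NX eq S by metis
  qed
  define d where "d = Max D"
  have dD: "degree (coeff S d) \<noteq> 0" using Max_in[OF finD \<open>D \<noteq> {}\<close>] by (simp add: d_def D_def)
  have S_hi: "degree (coeff S i) = 0" if "d < i" for i
    using that Max_ge[OF finD, of i] unfolding d_def D_def by fastforce
  \<comment> \<open>V(z) is the coefficient of index \<open>e\<close> in \<open>x\<close> of
    S(P(x,y),z) - S(P(x,y),0): the constant coefficients of \<open>S\<close> above \<open>d\<close>
    cancel. U(y) is the value of \<open>coeff T e\<close> at P(y,0).\<close>
  define e where "e = d * p"
  define V where "V = smult (\<alpha> ^ d) (coeff S d - [:poly (coeff S d) 0:])"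
  define U where "U = pcompose (coeff T e) (sect P 0)"
  have TUV: "poly (coeff T e) (ev2 P y z) = poly U y + poly V z" for y z
  proof -
    have "degree (sect S z - sect S 0) \<le> d"
    proof (rule degree_le, intro allI impI)
      fix i assume "d < i"
      then obtain c where "coeff S i = [:c:]" using S_hi by (metis degree_eq_zeroE)
      then show "coeff (sect S z - sect S 0) i = 0" by simp
    qed
    then have "coeff (pcompose (sect S z - sect S 0) (sect P y)) e
        = coeff (sect S z - sect S 0) d * coeff (sect P y) p ^ d"
      unfolding e_def by (rule coeff_pcompose_bound[OF _ dP p_pos])
    also have "\<dots> = poly V z"
      by (simp add: V_def a_def[symmetric] \<alpha> mult.commute)
    finally have "poly V z = poly (coeff T e) (ev2 P y z) - poly (coeff T e) (ev2 P y 0)"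
      by (simp add: coeffs pcompose_diff)
    then show ?thesis by (simp add: U_def poly_pcompose poly_sect)
  qed
  define m where "m = degree (coeff T e)"
  have V1: "degree V \<noteq> 0"
  proof
    assume "degree V = 0"
    then have "degree (coeff S d - [:poly (coeff S d) 0:]) = 0" using \<alpha>(2) by (simp add: V_def)
    then obtain c where "coeff S d - [:poly (coeff S d) 0:] = [:c:]" by (metis degree_eq_zeroE)
    then have "coeff S d = [:c + poly (coeff S d) 0:]" by (simp add: diff_eq_eq)
    then show False using dD by (metis degree_pCons_0)
  qed
  have "m \<noteq> 0"
  proof
    assume "m = 0"
    then obtain c where c: "coeff T e = [:c:]" unfolding m_def by (metis degree_eq_zeroE)
    have "poly V z = c - poly U 0" for z using TUV[of 0 z] by (simp add: c algebra_simps)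
    then have "V = [:c - poly U 0:]" by (intro ext) simp
    then show False using V1 by (metis degree_pCons_0)
  qed
  have degU: "degree U = m * p" by (simp add: U_def m_def degree_pcompose degP)
  \<comment> \<open>Put \<open>y = z\<close> in \<open>TUV\<close>.\<close>
  have "V = coeff T e - U"
    by (rule ext) (use TUV P_id in \<open>metis add_diff_cancel_left' poly_diff\<close>)
  then have degV: "degree V \<le> m * p"
    using degree_diff_le[of "coeff T e" "m * p" U] degU m_def p2 by simp
  \<comment> \<open>Substitute \<open>y = c * x\<close>, \<open>z = x\<close> in \<open>TUV\<close>:
    the right side has degree at most \<open>m * p\<close> in \<open>x\<close>, the left side
    \<open>m\<close> times the degree of P(c x, x).\<close>
  have P_line: "degree (poly P [:0, c:]) \<le> p" for c
  proof -
    have "pcompose (coeff T e) (poly P [:0, c:]) = pcompose U [:0, c:] + V"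
      by (rule ext) (simp add: poly_pcompose poly_poly_eq_ev2 TUV mult.commute)
    moreover have "degree (pcompose U [:0, c:]) \<le> m * p"
      using degree_pcompose_le[of U "[:0, c:]"] degU by (cases "c = 0") auto
    ultimately have "m * degree (poly P [:0, c:]) \<le> m * p"
      using degV by (metis degree_add_le degree_pcompose m_def)
    then show ?thesis using \<open>m \<noteq> 0\<close> by simp
  qed

  text \<open>Hence \<open>T(ct, P(t,0))\<close> has degree at most \<open>s p\<close> in \<open>t\<close> for every \<open>c\<close>.\<close>
  have T_low: "i + degree (coeff T i) * p \<le> t" if "coeff T i \<noteq> 0" for i
  proof -
    \<comment> \<open>T(c x, P(x,0)) is the sum of the \<open>c ^ j\<close> times
      \<open>q j\<close>, a polynomial in both \<open>c\<close> and \<open>x\<close>.\<close>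
    define q where "q j = monom 1 j * pcompose (coeff T j) (sect P 0)" for j
    have T_line: "pcompose (sect S 0) (poly P [:0, c:]) = (\<Sum>j\<le>degree T. smult (c ^ j) (q j))" for c
    proof (rule ext)
      fix x
      have "poly (pcompose (sect S 0) (poly P [:0, c:])) x = ev2 T (c * x) (ev2 P x 0)"
        by (simp add: poly_pcompose poly_poly_eq_ev2 poly_sect eq mult.commute)
      also have "\<dots> = (\<Sum>j\<le>degree T. poly (coeff T j) (ev2 P x 0) * (c * x) ^ j)"
        by (rule ev2_altdef)
      finally show "poly (pcompose (sect S 0) (poly P [:0, c:])) x
          = poly (\<Sum>j\<le>degree T. smult (c ^ j) (q j)) x"
        by (simp add: q_def poly_sum poly_monom poly_pcompose poly_sect power_mult_distrib mult_ac)
    qed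
    have "degree (q i) \<le> t"
    proof (rule degree_le, intro allI impI)
      fix n assume "t < n"
      \<comment> \<open>For fixed \<open>n > t\<close> this polynomial in \<open>c\<close> vanishes
        everywhere, so each of its coefficients is zero.\<close>
      have "(\<Sum>j\<le>degree T. monom (coeff (q j) n) j) = 0"
      proof (rule ext)
        fix c
        have "degree (pcompose (sect S 0) (poly P [:0, c:])) \<le> t"
          using degree_pcompose_le[of "sect S 0" "poly P [:0, c:]"]
            mult_le_mono[OF dS[of 0] P_line[of c]] by (simp add: t_def)
        then have "coeff (\<Sum>j\<le>degree T. smult (c ^ j) (q j)) n = 0"
          using \<open>t < n\<close> by (metis T_line coeff_eq_0 le_less_trans)
        then show "poly (\<Sum>j\<le>degree T. monom (coeff (q j) n) j) c = poly 0 c"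
          by (simp add: poly_sum poly_monom coeff_sum mult.commute)
      qed
      then have "coeff (\<Sum>j\<le>degree T. monom (coeff (q j) n) j) i = 0" by simp
      moreover have "i \<le> degree T" using that by (rule le_degree)
      ultimately show "coeff (q i) n = 0" by (simp add: coeff_sum)
    qed
    moreover have "pcompose (coeff T i) (sect P 0) \<noteq> 0"
      using that degP[of 0] p_pos by (simp add: pcompose_eq_0_iff)
    ultimately show ?thesis
      by (simp add: q_def degree_mult_eq degree_monom_eq degree_pcompose degP)
  qed

  \<comment> \<open>T(x,x) = x has no term of degree \<open>t \<ge> 2\<close>. By
    \<open>T_low\<close> and \<open>p \<ge> 2\<close>, only \<open>i = t\<close> can contribute to
    that degree, and its contribution is the nonzero constant \<open>coeff T t\<close>.\<close>
  have "poly T [:0, 1:] = [:0, 1:]"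
    by (rule ext) (simp add: poly_poly_eq_ev2 T_id)
  moreover have "2 \<le> t" using s_pos p2 mult_le_mono[of 1 s 2 p] by (simp add: t_def)
  ultimately have "coeff (poly T [:0, 1:]) t = 0" by (simp add: coeff_pCons split: nat.split)
  moreover have "coeff (poly T [:0, 1:]) t = (\<Sum>i\<le>degree T. coeff (monom 1 i * coeff T i) t)"
    by (simp add: poly_altdef coeff_sum monom_altdef mult.commute)
  moreover have "\<dots> = (\<Sum>i\<le>degree T. if i = t then coeff (coeff T t) 0 else 0)"
  proof (rule sum.cong)
    fix i
    have "coeff (coeff T i) (t - i) = 0" if "i < t"
    proof (cases "coeff T i = 0")
      case False
      have "degree (coeff T i) < t - i"
        using T_low[OF False] p2 that mult_le_mono2[OF p2, of "degree (coeff T i)"] by linarith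
      then show ?thesis by (rule coeff_eq_0)
    qed simp
    then show "coeff (monom 1 i * coeff T i) t = (if i = t then coeff (coeff T t) 0 else 0)"
      by (auto simp: coeff_monom_mult)
  qed simp
  moreover have "t \<le> degree T" using Tt0 by (rule le_degree)
  ultimately have "coeff (coeff T t) 0 = 0" by simp
  moreover have "degree (coeff T t) = 0"
    using ab a0 b0 by (simp add: Tt degree_mult_eq degree_power_eq)
  ultimately show False using Tt0 by (metis degree_eq_zeroE coeff_pCons_0 pCons_0_0)
qed

section \<open>Multivariate polynomial functions\<close>

definition mono_eval :: "(nat \<Rightarrow>\<^sub>0 nat) \<Rightarrow> 'a::comm_semiring_1 list \<Rightarrow> 'a" where
  "mono_eval m xs = (\<Prod>i\<in>Poly_Mapping.keys m. (xs ! i) ^ Poly_Mapping.lookup m i)"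

lemma mono_eval_superset:
  assumes "finite I" "Poly_Mapping.keys m \<subseteq> I"
  shows "mono_eval m xs = (\<Prod>i\<in>I. (xs ! i) ^ Poly_Mapping.lookup m i)"
  unfolding mono_eval_def using assms
  by (intro prod.mono_neutral_left) (auto simp: in_keys_iff)

lemma mpol_eval_superset:
  assumes "finite A" "Poly_Mapping.keys p \<subseteq> A"
  shows "mpol_eval p xs = (\<Sum>m\<in>A. Poly_Mapping.lookup p m * mono_eval m xs)"
  unfolding mpol_eval_def mono_eval_def[symmetric] using assms
  by (intro sum.mono_neutral_left) (auto simp: in_keys_iff)

lemma mpol_eval_add: "mpol_eval (p + q) xs = mpol_eval p xs + mpol_eval q xs"
proof -
  let ?A = "Poly_Mapping.keys p \<union> Poly_Mapping.keys q"
  have "mpol_eval r xs = (\<Sum>m\<in>?A. Poly_Mapping.lookup r m * mono_eval m xs)"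
    if "r \<in> {p, q, p + q}" for r
    using that Poly_Mapping.keys_add[of p q] by (intro mpol_eval_superset) auto
  then show ?thesis
    by (simp add: lookup_add distrib_right sum.distrib)
qed

lemma mpol_eval_sum: "mpol_eval (\<Sum>i\<in>I. p i) xs = (\<Sum>i\<in>I. mpol_eval (p i) xs)"
  by (induction I rule: infinite_finite_induct) (simp_all add: mpol_eval_add mpol_eval_def[of 0])

lemma mpol_in_sum:
  assumes "\<And>i. i \<in> I \<Longrightarrow> mpol_in n (p i)"
  shows "mpol_in n (\<Sum>i\<in>I. p i)"
  using assms
proof (induction I rule: infinite_finite_induct)
  case (insert i I)
  then show ?case
    using Poly_Mapping.keys_add[of "p i" "\<Sum>j\<in>I. p j"] by (fastforce simp: mpol_in_def)
qed (simp_all add: mpol_in_def)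

lemma mpol_eval_ev2:
  assumes "mpol_in n p" "\<And>i. i < n \<Longrightarrow> xs ! i = ev2 (G i) x y"
  shows "mpol_eval p xs = ev2 (\<Sum>m\<in>Poly_Mapping.keys p. [:[:Poly_Mapping.lookup p m:]:] *
           (\<Prod>i\<in>Poly_Mapping.keys m. G i ^ Poly_Mapping.lookup m i)) x y"
proof -
  have "xs ! i = poly (poly (G i) [:x:]) y" if "m \<in> Poly_Mapping.keys p" "i \<in> Poly_Mapping.keys m" for m i
    using that assms unfolding mpol_in_def ev2_def by blast
  then show ?thesis
    unfolding mpol_eval_def by (simp add: ev2_def poly_sum poly_prod)
qed

text \<open>All degree arguments take place on tuples whose entries are polynomials in one or two
  parameters.\<close>

lemma polynomial_function_ev2:
  fixes F :: "'a::idom list \<Rightarrow> 'a"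
  assumes "polynomial_function F" "Gs \<noteq> []"
  obtains H where "\<And>x y. F (map (\<lambda>G. ev2 G x y) Gs) = ev2 H x y"
proof -
  have "1 \<le> length Gs" using assms(2) by (cases Gs) auto
  then obtain p where p: "mpol_in (length Gs) p"
      "\<And>xs. length xs = length Gs \<Longrightarrow> F xs = mpol_eval p xs"
    using assms(1) unfolding polynomial_function_def by metis
  show thesis
    by (rule that, subst p(2), simp, rule mpol_eval_ev2[OF p(1), where G = "\<lambda>i. Gs ! i"]) simp
qed

lemma polynomial_function_poly:
  fixes F :: "'a::idom list \<Rightarrow> 'a"
  assumes "polynomial_function F" "gs \<noteq> []"
  obtains h where "\<And>t. F (map (\<lambda>g. poly g t) gs) = poly h t"
proof -
  obtain H where H: "\<And>x y. F (map (\<lambda>G. ev2 G x y) (map (\<lambda>g. [:g:]) gs)) = ev2 H x y"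
    using assms polynomial_function_ev2[of F "map (\<lambda>g. [:g:]) gs"] by auto
  then have "F (map (\<lambda>g. poly g t) gs) = poly (poly H 0) t" for t
    using H[of 0 t] by (simp add: ev2_def o_def)
  then show thesis by (rule that)
qed

text \<open>The translation back, which turns the quotient found in
  \<open>idempotent_ev2_factor\<close> into the \<open>Q\<close> of condition (ii).\<close>

lemma ev2_mpol:
  obtains p where "mpol_in 2 p" "\<And>x y. mpol_eval p [x, y] = ev2 H x y"
proof -
  define mon where "mon i j = Poly_Mapping.single (0::nat) i + Poly_Mapping.single 1 j" for i j :: nat
  define p where "p = (\<Sum>i\<le>degree H. \<Sum>j\<le>degree (coeff H i).
    Poly_Mapping.single (mon i j) (coeff (coeff H i) j))"
  have keys: "Poly_Mapping.keys (mon i j) \<subseteq> {0, 1}" for i j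
    unfolding mon_def by (rule order_trans[OF Poly_Mapping.keys_add]) auto
  have mon: "mono_eval (mon i j) [x, y] = x ^ i * y ^ j" for i j and x y :: 'a
    by (subst mono_eval_superset[OF _ keys]) (simp_all add: mon_def lookup_add lookup_single)
  show thesis
  proof
    show "mpol_in 2 p" unfolding p_def
      by (intro mpol_in_sum) (use keys in \<open>fastforce simp: mpol_in_def\<close>)
    show "mpol_eval p [x, y] = ev2 H x y" for x y
    proof -
      have "mpol_eval (Poly_Mapping.single m c) [x, y] = c * mono_eval m [x, y]" for m c
        by (subst mpol_eval_superset[of "{m}"]) auto
      then show ?thesis
        by (simp add: p_def mpol_eval_sum mon ev2_altdef poly_altdef sum_distrib_left mult_ac)
    qed
  qed
qed

lemma mpol_eval_deg_0:
  assumes "total_deg p = 0"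
  shows "mpol_eval p xs = Poly_Mapping.lookup p 0"
proof -
  have "m = 0" if m: "m \<in> Poly_Mapping.keys p" for m
  proof -
    have "(\<Sum>i\<in>Poly_Mapping.keys m. Poly_Mapping.lookup m i) \<le> total_deg p"
      unfolding total_deg_def using m by (intro Max_ge) auto
    then have "Poly_Mapping.lookup m i = 0" if "i \<in> Poly_Mapping.keys m" for i
      using that assms by simp
    then have "Poly_Mapping.keys m = {}" by (metis all_not_in_conv in_keys_iff)
    then show ?thesis by simp
  qed
  then have "Poly_Mapping.keys p \<subseteq> {0}" by blast
  then show ?thesis
    by (subst mpol_eval_superset[of "{0}"]) (simp_all add: mono_eval_def)
qed

section \<open>Barycentric associativity\<close>

lemma B_associativeD:
  "B_associative F \<Longrightarrow> F (xs @ ys @ zs) = F (xs @ replicate (length ys) (F ys) @ zs)"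
  unfolding B_associative_def by blast

text \<open>Overwrite the first \<open>n\<close> entries by \<open>c\<close>, then the last
  \<open>n\<close>: the first entry is already \<open>c\<close>, so nothing of the tuple is
  left.\<close>

lemma const_part_Suc:
  assumes B: "B_associative F" and c: "const_part n F" and n: "1 \<le> n"
  shows "const_part (Suc n) F"
proof -
  obtain c where c: "F ys = c" if "length ys = n" for ys
    using c unfolding const_part_def by blast
  have "F xs = F (c # replicate n c)" if xs: "length xs = Suc n" for xs
  proof -
    have "xs = take n xs @ drop n xs" "length (take n xs) = n" using xs by auto
    then have "F xs = F (replicate n c @ drop n xs)"
      using B_associativeD[OF B, of "[]" "take n xs" "drop n xs"] c by simp
    also have "replicate n c @ drop n xs = [c] @ (replicate (n - 1) c @ drop n xs) @ []"
      using n by (cases n) auto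
    also have "F \<dots> = F ([c] @ replicate n c @ [])"
      using B_associativeD[OF B, of "[c]" "replicate (n - 1) c @ drop n xs" "[]"] c xs n by simp
    finally show ?thesis by simp
  qed
  then show ?thesis unfolding const_part_def by blast
qed

lemma const_part_mono:
  assumes "B_associative F" "const_part m F" "1 \<le> m" "m \<le> n"
  shows "const_part n F"
  using assms(4)
proof (induction n rule: dec_induct)
  case (step i)
  then show ?case using assms(1,3) by (intro const_part_Suc) auto
qed (rule assms(2))

text \<open>The diagonal polynomial \<open>h\<close> fixes every value of the \<open>n\<close>-ary
  part, so it is idempotent; if \<open>h\<close> is constant, so is that part.\<close>

lemma const_or_idempotent:
  fixes F :: "'a::idom list \<Rightarrow> 'a"
  assumes inf: "infinite (UNIV :: 'a set)" and "polynomial_function F"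
    and B: "B_associative F" and n: "1 \<le> n" and nc: "\<not> const_part n F"
  shows "F (replicate n x) = x"
proof -
  obtain h where h: "F (map (\<lambda>g. poly g t) (replicate n [:0, 1:])) = poly h t" for t
    using n polynomial_function_poly[OF assms(2), of "replicate n [:0, 1:]"] by auto
  then have h: "F (replicate n t) = poly h t" for t using h[of t] by simp
  have hF: "poly h (F xs) = F xs" if "length xs = n" for xs
    using B_associativeD[OF B, of "[]" xs "[]"] that by (simp add: h)
  have "poly h (poly h t) = poly h t" for t
    using hF[of "replicate n t"] by (simp add: h)
  then consider c where "h = [:c:]" | "h = [:0, 1:]"
    using idempotent_poly_cases[OF inf] by metis
  then show ?thesis
  proof cases
    case 1
    then have "F xs = c" if "length xs = n" for xs using hF[OF that] by simp
    then show ?thesis using nc unfolding const_part_def by blast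
  next
    case 2
    then show ?thesis by (simp add: h)
  qed
qed

section \<open>Weighted sums and the functions \<open>M\<close>\<close>

text \<open>The numerator of \<open>M\<close>, in a recursive form suited to induction on the
  tuple.\<close>

fun lsum :: "'a::comm_ring_1 \<Rightarrow> 'a list \<Rightarrow> 'a" where
  "lsum z [] = 0"
| "lsum z (x # xs) = z ^ length xs * x + (1 - z) * lsum z xs"

lemma lsum_eq:
  "lsum z xs = (\<Sum>i=1..length xs. z ^ (length xs - i) * (1 - z) ^ (i - 1) * xs ! (i - 1))"
proof (induction xs)
  case (Cons x xs)
  have "(\<Sum>i=1..length (x # xs). z ^ (length (x # xs) - i) * (1 - z) ^ (i - 1) * (x # xs) ! (i - 1))
      = z ^ length xs * x + (\<Sum>i=1..length xs. z ^ (length xs - i) * (1 - z) ^ i * xs ! (i - 1))"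
    by (simp add: sum.atLeast_Suc_atMost sum.shift_bounds_cl_Suc_ivl nth_Cons' del: sum.cl_ivl_Suc)
  also have "\<dots> = lsum z (x # xs)"
    unfolding lsum.simps Cons sum_distrib_left
    by (intro arg_cong2[where f = "(+)"] refl sum.cong) (auto simp: power_eq_if mult_ac)
  finally show ?case ..
qed simp

lemma lsum_append:
  "lsum z (xs @ ys) = z ^ length ys * lsum z xs + (1 - z) ^ length xs * lsum z ys"
  by (induction xs) (simp_all add: algebra_simps power_add)

lemma lsum_replicate: "lsum z (replicate n c) = Delta z n * c"
  by (auto simp: lsum_eq Delta_def sum_distrib_right intro!: sum.cong)

lemma lsum_map_mult: "lsum z (map ((*) c) xs) = c * lsum z xs"
  by (induction xs) (simp_all add: algebra_simps)

lemma mult_unit_inv: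
  fixes a :: "'a::comm_ring_1"
  assumes "a dvd 1"
  shows "a * unit_inv a = 1"
proof -
  obtain b where b: "a * b = 1" using assms by (metis dvdE)
  have "c = b" if "a * c = 1" for c
    using b that by (metis mult.assoc mult.commute mult_1_left)
  then have "\<exists>!b. a * b = 1" using b by blast
  then show ?thesis unfolding unit_inv_def by (rule theI')
qed

lemma Delta_dvd_1:
  assumes "1 \<le> n" "enat n < n_of z"
  shows "Delta z n dvd 1"
proof (rule ccontr)
  assume "\<not> Delta z n dvd 1"
  then have "n_of z \<le> enat n" unfolding n_of_def using assms(1) by (intro INF_lower) simp
  then show False using assms(2) by simp
qed

lemma Delta_mult_M:
  assumes "xs \<noteq> []" "enat (length xs) < n_of z"
  shows "Delta z (length xs) * M z xs = lsum z xs"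
proof -
  have "Delta z (length xs) * unit_inv (Delta z (length xs)) = 1"
    using assms by (intro mult_unit_inv Delta_dvd_1) (cases xs, auto)
  then show ?thesis
    using assms(2) by (simp add: M_def lsum_eq Let_def mult.assoc[symmetric])
qed

section \<open>Both families are B-associative\<close>

lemma const_part_cong:
  "const_part n F \<Longrightarrow> length xs = n \<Longrightarrow> length ys = n \<Longrightarrow> F xs = F ys"
  unfolding const_part_def by metis

text \<open>Below \<open>k\<close>, replacing a block by copies of its mean preserves the
  \<open>lsum\<close> of the block, hence that of the whole tuple, and the nonzero
  \<open>Delta\<close> cancels.\<close>

lemma repl_class_B_associative:
  fixes F :: "'a::idom list \<Rightarrow> 'a"
  assumes k: "k \<le> n_of z" and F: "F \<in> repl_class (M z) k"
  shows "B_associative F"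
  unfolding B_associative_def
proof (intro allI)
  fix xs ys zs
  let ?L = "xs @ ys @ zs" and ?R = "xs @ replicate (length ys) (F ys) @ zs"
  have len: "length ?L = length ?R" by simp
  show "F ?L = F ?R"
  proof (cases "ys = []")
    case False
    show ?thesis
    proof (cases "k \<le> enat (length ?L)")
      case True
      then have "const_part (length ?L) F"
        using F False unfolding repl_class_def by (cases ys) auto
      then show ?thesis by (rule const_part_cong) simp_all
    next
      case nk: False
      have eval: "Delta z (length us) * F us = lsum z us" "Delta z (length us) dvd 1"
        if "us \<noteq> []" "length us \<le> length ?L" for us
      proof -
        have *: "enat (length us) < k"
          using nk that(2) by (meson enat_ord_simps(1) le_less_trans not_le)
        then show "Delta z (length us) * F us = lsum z us"
          using F that(1) k unfolding repl_class_def by (simp add: Delta_mult_M less_le_trans)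
        show "Delta z (length us) dvd 1"
          using * k that(1) by (intro Delta_dvd_1) (cases us, auto)
      qed
      have "lsum z (replicate (length ys) (F ys)) = lsum z ys"
        using eval(1)[of ys] False by (simp add: lsum_replicate)
      then have "lsum z ?L = lsum z ?R" by (simp add: lsum_append)
      moreover have "Delta z (length ?L) * F ?L = lsum z ?L" "Delta z (length ?L) * F ?R = lsum z ?R"
        using eval(1)[of ?L] eval(1)[of ?R] False len by auto
      moreover have "Delta z (length ?L) \<noteq> 0" using eval(2)[of ?L] False by auto
      ultimately show ?thesis by (metis mult_left_cancel)
    qed
  qed simp
qed

text \<open>Only total length at most 2 matters, where a block is empty, a single entry or the whole
  pair.\<close>

lemma binary_B_associative:
  fixes F :: "'a::idom list \<Rightarrow> 'a"
  assumes F1: "\<And>x. F [x] = x" and F2: "\<And>x. F [x, x] = x" and F3: "\<And>n. 3 \<le> n \<Longrightarrow> const_part n F"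
  shows "B_associative F"
  unfolding B_associative_def
proof (intro allI)
  fix xs ys zs
  let ?L = "xs @ ys @ zs" and ?R = "xs @ replicate (length ys) (F ys) @ zs"
  show "F ?L = F ?R"
  proof (cases "3 \<le> length ?L")
    case True
    then show ?thesis using const_part_cong[OF F3[OF True]] by simp
  next
    case False
    then consider "ys = []" | y where "ys = [y]" | y y' where "ys = [y, y']" "xs = []" "zs = []"
      by (cases ys; cases "tl ys"; cases xs; cases "tl (tl ys)"; cases zs) auto
    then show ?thesis by cases (simp_all add: F1 F2)
  qed
qed

section \<open>B-associative functions with linear binary part\<close>

text \<open>\<open>k\<close> is the least arity at which \<open>F\<close> is constant, \<infinity>
  if there is none. Constancy passes upwards, \<open>unit\<close> gives
  \<open>k \<le> n_of z\<close>, and below \<open>k\<close> the factor \<open>Delta\<close>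
  cancels.\<close>

lemma repl_class_M_I:
  fixes F :: "'a::idom list \<Rightarrow> 'a"
  assumes B: "B_associative F"
    and unit: "\<And>n. 1 \<le> n \<Longrightarrow> \<not> const_part n F \<Longrightarrow> Delta z n dvd 1"
    and lsum: "\<And>xs. xs \<noteq> [] \<Longrightarrow> \<not> const_part (length xs) F \<Longrightarrow>
      Delta z (length xs) * F xs = lsum z xs"
  shows "\<exists>k. 1 \<le> k \<and> k \<le> n_of z \<and> F \<in> repl_class (M z) k"
proof (intro exI conjI)
  define N where "N = {n. 1 \<le> n \<and> const_part n F}"
  define k where "k = (INF n\<in>N. enat n)"
  show "1 \<le> k" unfolding k_def N_def by (intro INF_greatest) (simp add: one_enat_def)
  show kz: "k \<le> n_of z"
    unfolding k_def n_of_def N_def by (intro INF_superset_mono) (use unit in auto)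
  show "F \<in> repl_class (M z) k"
    unfolding repl_class_def
  proof (intro CollectI conjI allI impI)
    fix xs :: "'a list" assume xs: "xs \<noteq> [] \<and> enat (length xs) < k"
    have nc: "\<not> const_part (length xs) F"
    proof
      assume "const_part (length xs) F"
      then have "k \<le> enat (length xs)"
        unfolding k_def N_def using xs by (intro INF_lower) (cases xs, auto)
      then show False using xs by (meson leD)
    qed
    have "enat (length xs) < n_of z" using xs kz by (meson less_le_trans)
    then have "Delta z (length xs) * F xs = Delta z (length xs) * M z xs"
      using xs lsum[OF _ nc] by (simp add: Delta_mult_M)
    moreover have "Delta z (length xs) \<noteq> 0"
      using unit[OF _ nc] xs by (cases xs) auto
    ultimately show "F xs = M z xs" by simp
  next
    fix n :: nat assume n: "1 \<le> n" "k \<le> enat n"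
    then have "k < enat (Suc n)" by (simp add: le_less_trans)
    then obtain m where "m \<in> N" "m \<le> n" unfolding k_def by (auto simp: INF_less_iff)
    then show "const_part n F" using const_part_mono[OF B, of m n] by (auto simp: N_def)
  qed
qed

text \<open>Both tuples equal the one in which the pair is replaced by two copies of the common
  value.\<close>

lemma B_associative_pair:
  assumes "B_associative F" "F [x, y] = F [x', y']"
  shows "F (us @ x # y # vs) = F (us @ x' # y' # vs)"
  using B_associativeD[OF assms(1), of us "[x, y]" vs]
    B_associativeD[OF assms(1), of us "[x', y']" vs] assms(2) by simp

text \<open>\<open>F\<close> is unchanged by adding multiples of \<open>(1 - z, -z)\<close> to two consecutive entries. After
  scaling by a power of \<open>z\<close>, this moves all entries into the first position.\<close>

lemma B_associative_collapse:
  fixes F :: "'a::comm_ring_1 list \<Rightarrow> 'a"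
  assumes B: "B_associative F" and F2: "\<And>x y. F [x, y] = z * x + (1 - z) * y"
  shows "F (us @ map ((*) (c * z ^ length xs)) (x # xs) @ vs)
       = F (us @ c * lsum z (x # xs) # replicate (length xs) 0 @ vs)"
proof (induction xs arbitrary: us x c)
  case (Cons y ys)
  let ?u = "c * z ^ Suc (length ys) * x"
  have "F (us @ map ((*) (c * z ^ length (y # ys))) (x # y # ys) @ vs)
      = F ((us @ [?u]) @ map ((*) (c * z * z ^ length ys)) (y # ys) @ vs)"
    by (simp add: mult_ac)
  also have "\<dots> = F ((us @ [?u]) @ c * z * lsum z (y # ys) # replicate (length ys) 0 @ vs)"
    by (rule Cons.IH)
  also have "\<dots> = F (us @ ?u # c * z * lsum z (y # ys) # replicate (length ys) 0 @ vs)"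
    by simp
  also have "\<dots> = F (us @ c * lsum z (x # y # ys) # 0 # replicate (length ys) 0 @ vs)"
    by (rule B_associative_pair[OF B]) (simp add: F2 algebra_simps)
  finally show ?case by simp
qed simp

lemma lsum_0: "xs \<noteq> [] \<Longrightarrow> lsum 0 xs = last xs"
  by (induction xs) (auto simp: power_0_left)

text \<open>For \<open>z \<noteq> 0\<close>, collapsing gives F(w us) = h(lsum us) with h(t) =
  F(t,0,...,0), and the diagonal shows that h(t) = c t with \<open>c * D = w\<close>. The case
  \<open>z = 0\<close>, where \<open>w\<close> may vanish, is separate.\<close>

lemma B_associative_lsum:
  fixes F :: "'a::idom list \<Rightarrow> 'a"
  assumes inf: "infinite (UNIV :: 'a set)" and pf: "polynomial_function F"
    and B: "B_associative F" and F2: "\<And>x y. F [x, y] = z * x + (1 - z) * y"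
    and idem: "\<And>x. F (replicate (length xs) x) = x" and ne: "xs \<noteq> []"
  shows "Delta z (length xs) * F xs = lsum z xs"
proof (cases "z = 0")
  case True
  \<comment> \<open>Here the binary part is the second projection, so an entry followed by
    \<open>y\<close> can be overwritten by \<open>y\<close>.\<close>
  have *: "F (us @ replicate (Suc m) y) = F (replicate (length us + Suc m) y)" for us m y
  proof (induction us arbitrary: m rule: rev_induct)
    case (snoc u us)
    have "F ((us @ [u]) @ replicate (Suc m) y) = F (us @ replicate (Suc (Suc m)) y)"
      using B_associative_pair[OF B, of u y y y us "replicate m y"] by (simp add: F2 True)
    also have "\<dots> = F (replicate (length us + Suc (Suc m)) y)" by (rule snoc)
    finally show ?case by simp
  qed simp
  have "F xs = last xs"
    using *[of "butlast xs" 0 "last xs"] idem[of "last xs"] ne by simp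
  moreover have "Delta z (length xs) = 1"
    using lsum_replicate[of z "length xs" 1] ne by (simp add: True lsum_0)
  ultimately show ?thesis using ne by (simp add: True lsum_0)
next
  case False
  define w where "w = z ^ (length xs - 1)"
  have w0: "w \<noteq> 0" using False by (simp add: w_def)
  have "[:0, 1:] # replicate (length xs - 1) 0 \<noteq> ([] :: 'a poly list)" by simp
  then obtain h where "\<And>t. F (map (\<lambda>g. poly g t) ([:0, 1:] # replicate (length xs - 1) 0)) = poly h t"
    using polynomial_function_poly[OF pf] by blast
  then have h: "F (t # replicate (length xs - 1) 0) = poly h t" for t by (simp add: map_replicate_const)
  have collapse: "F (map ((*) w) us) = poly h (lsum z us)" if "length us = length xs" for us
  proof -
    have "us \<noteq> []" using that ne by auto
    then obtain v vs where "us = v # vs" by (metis neq_Nil_conv)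
    moreover have "length vs = length xs - 1" using calculation that by simp
    ultimately show ?thesis
      using B_associative_collapse[OF B F2, of "[]" 1 vs v "[]"] by (simp add: w_def h[symmetric])
  qed
  define D where "D = Delta z (length xs)"
  have hD: "pcompose h [:0, D:] = [:0, w:]"
  proof (rule poly_ext_infinite[OF inf])
    fix t
    show "poly (pcompose h [:0, D:]) t = poly [:0, w:] t"
      using collapse[of "replicate (length xs) t"] idem[of "w * t"]
      by (simp add: poly_pcompose lsum_replicate D_def map_replicate mult.commute)
  qed
  then have "degree h * degree [:0, D:] = 1"
    using w0 by (metis degree_pcompose degree_pCons_eq_if pCons_eq_0_iff One_nat_def degree_0)
  then have "degree h = 1" by simp
  then obtain b c where hbc: "h = [:b, c:]" by (metis degree1_coeffs)
  have hc: "h = [:0, c:]" and cD: "c * D = w" using hD by (simp_all add: hbc pcompose_pCons mult.commute)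
  \<comment> \<open>\<open>collapse\<close> only reaches multiples of \<open>w\<close>. Along the
    line through \<open>xs\<close>, q(w t) = c t lsum(xs) forces \<open>q\<close> to be linear
    without constant term, and q(1) is \<open>F xs\<close>.\<close>
  obtain q where "\<And>t. F (map (\<lambda>g. poly g t) (map (\<lambda>x. [:0, x:]) xs)) = poly q t"
    using polynomial_function_poly[OF pf] ne by (metis map_is_Nil_conv)
  then have q: "F (map ((*) t) xs) = poly q t" for t by (simp add: o_def)
  have qw: "pcompose q [:0, w:] = [:0, c * lsum z xs:]"
  proof (rule poly_ext_infinite[OF inf])
    fix t
    have scale: "map ((*) w) (map ((*) t) xs) = map ((*) (t * w)) xs" by (simp add: mult_ac)
    show "poly (pcompose q [:0, w:]) t = poly [:0, c * lsum z xs:] t"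
      using collapse[of "map ((*) t) xs", unfolded scale] q[of "t * w"]
      by (simp add: poly_pcompose hc lsum_map_mult mult_ac)
  qed
  have "w ^ i * coeff q i = coeff [:0, c * lsum z xs:] i" for i
    by (metis qw coeff_pcompose_linear)
  then have "coeff q i = 0" if "i \<noteq> 1" for i
    using that w0 by (metis coeff_pCons_0 coeff_pCons_Suc coeff_0 mult_eq_0_iff
      not0_implies_Suc One_nat_def power_not_zero)
  then have "q = [:0, coeff q 1:]"
    by (intro poly_eqI) (simp add: coeff_pCons split: nat.split)
  moreover have "w * coeff q 1 = c * lsum z xs"
    using \<open>\<And>i. w ^ i * coeff q i = _ i\<close>[of 1] by simp
  moreover have "F xs = poly q 1" using q[of 1] by (simp add: map_idI)
  ultimately have "w * F xs = c * lsum z xs"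
    by (metis add_0 mult_1 poly_0 poly_pCons mult_zero_right add.right_neutral)
  then have "w * (D * F xs) = w * lsum z xs" using cD by (metis mult.assoc mult.commute)
  then show ?thesis using w0 by (simp add: D_def)
qed

text \<open>Each binomial term has an exponent of \<open>x\<close> at least \<open>m\<close> or an
  exponent of \<open>y\<close> at least \<open>n\<close>.\<close>

lemma dvd_power_sum:
  fixes d x y :: "'a::comm_ring_1"
  assumes "d dvd x ^ m" "d dvd y ^ n"
  shows "d dvd (x + y) ^ (m + n)"
  unfolding binomial_ring
proof (rule dvd_sum)
  fix k assume "k \<in> {..m + n}"
  then have "d dvd x ^ k \<or> d dvd y ^ (m + n - k)"
    using assms by (cases "m \<le> k") (auto intro: dvd_trans[OF _ le_imp_power_dvd])
  then show "d dvd of_nat (m + n choose k) * x ^ k * y ^ (m + n - k)" by auto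
qed

lemma linear_binary_repl_class:
  fixes F :: "'a::idom list \<Rightarrow> 'a"
  assumes inf: "infinite (UNIV :: 'a set)" and pf: "polynomial_function F"
    and B: "B_associative F" and F2: "\<And>x y. F [x, y] = z * x + (1 - z) * y"
  shows "\<exists>k. 1 \<le> k \<and> k \<le> n_of z \<and> F \<in> repl_class (M z) k"
proof (rule repl_class_M_I[OF B])
  show lsum: "Delta z (length xs) * F xs = lsum z xs"
    if "xs \<noteq> []" "\<not> const_part (length xs) F" for xs
    using that const_or_idempotent[OF inf pf B _ that(2)]
    by (intro B_associative_lsum[OF inf pf B F2]) (cases xs, auto)
  fix n assume n: "1 \<le> n" "\<not> const_part n F"
  have dvd: "Delta z n dvd lsum z xs" if "length xs = n" for xs
    using lsum[of xs] n that by (metis dvd_triv_left length_0_conv not_one_le_zero)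
  \<comment> \<open>The values of \<open>lsum\<close> at the first and last unit vectors are the
    powers of \<open>z\<close> and \<open>1 - z\<close>.\<close>
  have "Delta z n dvd z ^ (n - 1)"
    using dvd[of "1 # replicate (n - 1) 0"] n by (simp add: lsum_replicate)
  moreover have "Delta z n dvd (1 - z) ^ (n - 1)"
    using dvd[of "replicate (n - 1) 0 @ [1]"] n by (simp add: lsum_append lsum_replicate)
  ultimately have "Delta z n dvd (z + (1 - z)) ^ (n - 1 + (n - 1))" by (rule dvd_power_sum)
  then show "Delta z n dvd 1" by simp
qed

text \<open>As a polynomial in \<open>x\<close>, P(x,y) - y has the root \<open>x = y\<close>;
  \<open>H\<close> is its quotient by \<open>x - y\<close>.\<close>

lemma idempotent_ev2_factor:
  fixes P :: "'a::idom poly poly"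
  assumes inf: "infinite (UNIV :: 'a set)" and P: "\<And>x. ev2 P x x = x"
  obtains H where "\<And>x y. ev2 P x y = ev2 H x y * x + (1 - ev2 H x y) * y"
proof -
  have "poly P [:0, 1:] = [:0, 1:]"
    by (rule poly_ext_infinite[OF inf]) (simp add: poly_poly_eq_ev2 P)
  then have "poly (P - [:[:0, 1:]:]) [:0, 1:] = 0" by simp
  then obtain H where H: "P - [:[:0, 1:]:] = [:- [:0, 1:], 1:] * H"
    unfolding poly_eq_0_iff_dvd by (elim dvdE)
  have "ev2 P x y - y = (x - y) * ev2 H x y" for x y
  proof -
    have "ev2 P x y - y = poly (poly (P - [:[:0, 1:]:]) [:x:]) y" by (simp add: ev2_def)
    then show ?thesis unfolding H by (simp add: ev2_def algebra_simps)
  qed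
  then have "ev2 P x y = ev2 H x y * x + (1 - ev2 H x y) * y" for x y
    by (simp add: algebra_simps diff_eq_eq)
  then show thesis by (rule that)
qed

lemma ternary_nonconst_binary_linear:
  fixes F :: "'a::idom list \<Rightarrow> 'a"
  assumes inf: "infinite (UNIV :: 'a set)" and pf: "polynomial_function F"
    and B: "B_associative F" and nc: "\<not> const_part 3 F"
  obtains z where "\<And>x y. F [x, y] = z * x + (1 - z) * y"
proof -
  define X Y :: "'a poly poly" where "X = [:0, 1:]" and "Y = [:[:0, 1:]:]"
  have XY [simp]: "ev2 X x y = x" "ev2 Y x y = y" for x y by (simp_all add: X_def Y_def ev2_def)
  obtain P where P: "\<And>x y. F [x, y] = ev2 P x y"
    using polynomial_function_ev2[OF pf, of "[X, Y]"] by auto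
  obtain S where S: "\<And>x y. F [x, x, y] = ev2 S x y"
    using polynomial_function_ev2[OF pf, of "[X, X, Y]"] by auto
  obtain T where T: "\<And>x y. F [x, y, y] = ev2 T x y"
    using polynomial_function_ev2[OF pf, of "[X, Y, Y]"] by auto
  have "\<not> const_part 2 F" using const_part_Suc[OF B, of 2] nc by (auto simp: numeral_3_eq_3 numeral_2_eq_2)
  then have F2: "F [x, x] = x" and F3: "F [x, x, x] = x" for x
    using const_or_idempotent[OF inf pf B _ nc, of x] const_or_idempotent[OF inf pf B, of 2 x]
    by (simp_all add: numeral_3_eq_3 numeral_2_eq_2)
  \<comment> \<open>Both sides equal F(x,y,z), with the first or the last two entries replaced by
    their mean.\<close>
  have "ev2 S (ev2 P x y) z = ev2 T x (ev2 P y z)" for x y z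
    using B_associativeD[OF B, of "[]" "[x, y]" "[z]"] B_associativeD[OF B, of "[x]" "[y, z]" "[]"]
    by (simp add: P[symmetric] S[symmetric] T[symmetric])
  then have "\<exists>\<alpha>. \<forall>x y. ev2 P x y = \<alpha> * x + (1 - \<alpha>) * y"
    by (intro barycentric_linear[OF inf, where S = S and T = T]) (simp_all add: P[symmetric] S[symmetric] T[symmetric] F2 F3)
  then show thesis using that P by metis
qed

theorem mainTheorem1:
  fixes F :: "'a::idom list \<Rightarrow> 'a"
  assumes "infinite (UNIV :: 'a set)"
    and "polynomial_function F"
  shows "B_associative F \<longleftrightarrow>
     (\<exists>(z::'a) (k::enat). 1 \<le> k \<and> k \<le> n_of z \<and> F \<in> repl_class (M z) k) \<or>
     (\<exists>Q :: 'a mpol. mpol_in 2 Q \<and> 1 \<le> total_deg Q \<and>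
        (\<forall>x. F [x] = x) \<and>
        (\<forall>x y. F [x, y] = mpol_eval Q [x, y] * x + (1 - mpol_eval Q [x, y]) * y) \<and>
        (\<forall>n\<ge>3. const_part n F))"
    (is "_ \<longleftrightarrow> ?M \<or> ?B")
proof
  assume B: "B_associative F"
  note idem = const_or_idempotent[OF assms B]
  have linear: ?M if "\<And>x y. F [x, y] = z * x + (1 - z) * y" for z
    using linear_binary_repl_class[OF assms B that] by blast
  show "?M \<or> ?B"
  proof (cases "const_part 2 F")
    case True
    \<comment> \<open>Only the unary part can be nonconstant, and \<open>Delta z 1 = 1\<close> for
      every \<open>z\<close>; \<open>z = 0\<close> is an arbitrary choice.\<close>
    have "\<exists>k. 1 \<le> k \<and> k \<le> n_of (0::'a) \<and> F \<in> repl_class (M 0) k"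
    proof (rule repl_class_M_I[OF B])
      fix n assume "1 \<le> n" "\<not> const_part n F"
      then have "n = 1" using const_part_mono[OF B True, of n] by (cases "n = 1") auto
      then show "Delta (0::'a) n dvd 1" by (simp add: Delta_def)
    next
      fix xs :: "'a list" assume xs: "xs \<noteq> []" "\<not> const_part (length xs) F"
      then have "length xs = 1"
        using const_part_mono[OF B True, of "length xs"] by (cases xs; cases "tl xs") auto
      then obtain x where "xs = [x]" by (metis One_nat_def length_0_conv length_Suc_conv)
      then show "Delta 0 (length xs) * F xs = lsum 0 xs"
        using idem[of 1 x] xs(2) by (simp add: Delta_def)
    qed
    then show ?thesis by blast
  next
    case nc2: False
    then have "\<not> const_part 1 F" using const_part_Suc[OF B, of 1] by (auto simp: numeral_2_eq_2)
    then have F1: "F [x] = x" and F2: "F [x, x] = x" for x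
      using idem[of 1 x] idem[OF _ nc2, of x] by (simp_all add: numeral_2_eq_2)
    show ?thesis
    proof (cases "const_part 3 F")
      case True
      obtain P where P: "\<And>x y. F [x, y] = ev2 P x y"
        using polynomial_function_ev2[OF assms(2), of "[[:0, 1:], [:[:0, 1:]:]]"]
        by (auto simp: ev2_def)
      obtain H where H: "\<And>x y. ev2 P x y = ev2 H x y * x + (1 - ev2 H x y) * y"
        using idempotent_ev2_factor[OF assms(1), of P] F2 by (auto simp: P)
      obtain Q where Q: "mpol_in 2 Q" "\<And>x y. mpol_eval Q [x, y] = ev2 H x y"
        using ev2_mpol by blast
      show ?thesis
      proof (cases "total_deg Q = 0")
        \<comment> \<open>A constant \<open>Q\<close> makes the binary part linear, which leads back
          to condition (i).\<close>
        case True
        then have "F [x, y] = Poly_Mapping.lookup Q 0 * x + (1 - Poly_Mapping.lookup Q 0) * y" for x y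
          using P H Q(2) mpol_eval_deg_0[OF True] by metis
        then show ?thesis using linear by blast
      next
        case False
        then have ?B
          using Q F1 P H const_part_mono[OF B True] by (intro exI[of _ Q]) auto
        then show ?thesis ..
      qed
    next
      case False
      then show ?thesis
        using ternary_nonconst_binary_linear[OF assms B] linear by metis
    qed
  qed
next
  assume "?M \<or> ?B"
  then show "B_associative F"
  proof
    assume ?M
    then show ?thesis using repl_class_B_associative by blast
  next
    assume ?B
    then obtain Q :: "'a mpol" where "\<And>x. F [x] = x" "\<And>n. 3 \<le> n \<Longrightarrow> const_part n F"
      and F2: "\<And>x y. F [x, y] = mpol_eval Q [x, y] * x + (1 - mpol_eval Q [x, y]) * y"
      by blast
    moreover have "F [x, x] = x" for x using F2[of x x] by (simp add: left_diff_distrib)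
    ultimately show ?thesis by (intro binary_B_associative)
  qed
qed

end
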